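(* Let $S$ be an additively cancellative semiring and let $X_1,\ldots,X_k$ be indeterminates over $S$. Then the multiplicatively idempotent elements of $S[[X_1,X_2,\ldots,X_k]]$ and of $S$ are the same; that is, an element of $S[[X_1,\ldots,X_k]]$ is multiplicatively idempotent if and only if it is a constant $e\in S$ with $e^2=e$.
   Context: A semiring is a set $S$ with operations $+,\cdot$ such that $(S,+,0)$ and $(S,\cdot,1)$ are commutative monoids with $1\neq 0$, multiplication distributes over addition, and $s\cdot 0=0$ for all $s$. $S$ is additively cancellative if $a+b=a+c$ implies $b=c$ for all $a,b,c\in S$. An element $x$ is multiplicatively idempotent if $x^2=x$. $S[[X_1,\ldots,X_k]]$ is the semiring of formal power series, and $S$ is identified with the constant power series. *)

theory Defs
  imports "HOL-Library.Function_Algebras" "HOL-Library.FuncSet"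
begin

text \<open>
  Formal power series over \<open>'a\<close> in finitely many indeterminates indexed by \<open>'k\<close>,
  so that the number of indeterminates is \<open>CARD('k)\<close>. A monomial is given by its
  exponent vector \<open>'k \<Rightarrow> nat\<close>; exponent vectors are added pointwise.
\<close>

typedef ('a, 'k) mfps = "UNIV :: (('k \<Rightarrow> nat) \<Rightarrow> 'a) set"
  morphisms mfps_coeff Abs_mfps ..

setup_lifting type_definition_mfps

lemma mfps_eq_iff: "f = g \<longleftrightarrow> (\<forall>n. mfps_coeff f n = mfps_coeff g n)"
  by (simp add: mfps_coeff_inject [symmetric] fun_eq_iff)

definition splits :: "('k \<Rightarrow> nat) \<Rightarrow> (('k \<Rightarrow> nat) \<times> ('k \<Rightarrow> nat)) set" where
  "splits n = {(i, j). i + j = n}"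

lemma mem_splits_iff [simp]: "(i, j) \<in> splits n \<longleftrightarrow> i + j = n"
  by (simp add: splits_def)

lemma finite_splits [simp]: "finite (splits (n :: 'k::finite \<Rightarrow> nat))"
proof (rule finite_subset)
  have "{i. \<forall>x. i x \<le> n x} = (\<Pi>\<^sub>E x\<in>UNIV. {..n x})"
    by (auto simp: PiE_def Pi_def)
  then show "finite ({i. \<forall>x. i x \<le> n x} \<times> {i. \<forall>x. i x \<le> n x})"
    by (simp add: finite_PiE)
  show "splits n \<subseteq> {i. \<forall>x. i x \<le> n x} \<times> {i. \<forall>x. i x \<le> n x}"
    by (auto simp: splits_def)
qed

lift_definition mfps_const :: "'a::zero \<Rightarrow> ('a, 'k) mfps" is
  "\<lambda>c n. if n = 0 then c else 0" .

instantiation mfps :: (comm_semiring_1, finite) comm_semiring_1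
begin

lift_definition zero_mfps :: "('a, 'b) mfps" is "\<lambda>n. 0" .

lift_definition one_mfps :: "('a, 'b) mfps" is "\<lambda>n. if n = 0 then 1 else 0" .

lift_definition plus_mfps :: "('a, 'b) mfps \<Rightarrow> ('a, 'b) mfps \<Rightarrow> ('a, 'b) mfps" is
  "\<lambda>f g n. f n + g n" .

lift_definition times_mfps :: "('a, 'b) mfps \<Rightarrow> ('a, 'b) mfps \<Rightarrow> ('a, 'b) mfps" is
  "\<lambda>f g n. \<Sum>(i, j)\<in>splits n. f i * g j" .

instance
proof
  fix f g h :: "('a, 'b) mfps"
  show "f + g + h = f + (g + h)"
    by transfer (simp add: add.assoc)
  show "f + g = g + f"
    by transfer (simp add: add.commute)
  show "0 + f = f"
    by transfer simp
  show "0 * f = 0" "f * 0 = 0"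
    by (transfer, simp)+
  show "(0 :: ('a, 'b) mfps) \<noteq> 1"
    by transfer (metis zero_neq_one)
  show "(f + g) * h = f * h + g * h"
    by transfer (simp add: distrib_right sum.distrib case_prod_unfold)
  show "f * g = g * f"
  proof (transfer, rule ext)
    fix f g :: "('b \<Rightarrow> nat) \<Rightarrow> 'a" and n
    show "(\<Sum>(i, j)\<in>splits n. f i * g j) = (\<Sum>(i, j)\<in>splits n. g i * f j)"
      by (rule sum.reindex_bij_witness [of _ prod.swap prod.swap])
        (auto simp: mult.commute add.commute)
  qed
  show "1 * f = f"
  proof (transfer, rule ext)
    fix f :: "('b \<Rightarrow> nat) \<Rightarrow> 'a" and n
    have "(\<Sum>(i, j)\<in>splits n. (if i = 0 then 1 else 0) * f j)
        = (\<Sum>(i, j)\<in>{(0 :: 'b \<Rightarrow> nat, n)}. (if i = 0 then 1 else 0) * f j)"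
      by (rule sum.mono_neutral_right) (auto split: if_splits)
    then show "(\<Sum>(i, j)\<in>splits n. (if i = 0 then 1 else 0) * f j) = f n"
      by simp
  qed
  show "f * g * h = f * (g * h)"
  proof (transfer, rule ext)
    fix f g h :: "('b \<Rightarrow> nat) \<Rightarrow> 'a" and n
    have "(\<Sum>(p, l)\<in>splits n. (\<Sum>(i, j)\<in>splits p. f i * g j) * h l)
        = (\<Sum>x\<in>splits n. \<Sum>y\<in>splits (fst x). f (fst y) * g (snd y) * h (snd x))"
      by (simp add: case_prod_unfold sum_distrib_right)
    also have "\<dots> = (\<Sum>(x, y)\<in>(SIGMA x:splits n. splits (fst x)).
        f (fst y) * g (snd y) * h (snd x))"
      by (rule sum.Sigma) auto
    also have "\<dots> = (\<Sum>(x, y)\<in>(SIGMA x:splits n. splits (snd x)).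
        f (fst x) * (g (fst y) * h (snd y)))"
      by (rule sum.reindex_bij_witness [of _
            "\<lambda>((i, q), (j, l)). ((i + j, l), (i, j))"
            "\<lambda>((p, l), (i, j)). ((i, j + l), (j, l))"])
        (auto simp: ac_simps)
    also have "\<dots> = (\<Sum>x\<in>splits n. \<Sum>y\<in>splits (snd x).
        f (fst x) * (g (fst y) * h (snd y)))"
      by (rule sum.Sigma [symmetric]) auto
    also have "\<dots> = (\<Sum>(i, q)\<in>splits n. f i * (\<Sum>(j, l)\<in>splits q. g j * h l))"
      by (simp add: case_prod_unfold sum_distrib_left)
    finally show "(\<Sum>(p, l)\<in>splits n. (\<Sum>(i, j)\<in>splits p. f i * g j) * h l)
        = (\<Sum>(i, q)\<in>splits n. f i * (\<Sum>(j, l)\<in>splits q. g j * h l))" .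
  qed
qed

end

text \<open>The identification of the coefficient semiring with the constant power series.\<close>

lemma mfps_const_inject: "mfps_const a = mfps_const b \<longleftrightarrow> a = b"
  by transfer (metis (full_types))

lemma mfps_const_0: "mfps_const 0 = (0 :: ('a::comm_semiring_1, 'k::finite) mfps)"
  by transfer simp

lemma mfps_const_1: "mfps_const 1 = (1 :: ('a::comm_semiring_1, 'k::finite) mfps)"
  by transfer simp

lemma mfps_const_add:
  "mfps_const (a + b) = (mfps_const a + mfps_const b :: ('a::comm_semiring_1, 'k::finite) mfps)"
  by transfer (simp add: fun_eq_iff)

lemma mfps_const_mult:
  "mfps_const (a * b) = (mfps_const a * mfps_const b :: ('a::comm_semiring_1, 'k::finite) mfps)"
proof (transfer, rule ext)
  fix a b :: 'a and n :: "'k \<Rightarrow> nat"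
  have "(\<Sum>(i, j)\<in>splits n. (if i = 0 then a else 0) * (if j = 0 then b else 0))
      = (\<Sum>(i, j)\<in>{(0 :: 'k \<Rightarrow> nat, n)}. (if i = 0 then a else 0) * (if j = 0 then b else 0))"
    by (rule sum.mono_neutral_right) (auto split: if_splits)
  then show "(if n = 0 then a * b else 0)
      = (\<Sum>(i, j)\<in>splits n. (if i = 0 then a else 0) * (if j = 0 then b else 0))"
    by simp
qed

text \<open>
  The class \<open>cancel_ab_semigroup_add\<close> also postulates a difference operation satisfying
  \<open>a - b - c = a - (b + c)\<close>; additive cancellativity is therefore stated on its own.
\<close>

definition additively_cancellative :: "'a::comm_semiring_1 itself \<Rightarrow> bool" where
  "additively_cancellative _ \<longleftrightarrow> (\<forall>a b c :: 'a. a + b = a + c \<longrightarrow> b = c)"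

definition mult_idempotent :: "'a::comm_semiring_1 \<Rightarrow> bool" where
  "mult_idempotent x \<longleftrightarrow> x\<^sup>2 = x"

end

theory Submission
  imports Defs
begin

text \<open>
  Write \<open>e\<close> for the constant coefficient of an idempotent \<open>f\<close>. By induction on the total degree,
  the nonconstant coefficients vanish: if all those of degree below that of \<open>n \<noteq> 0\<close> do, then
  comparing coefficients in \<open>f\<^sup>2 = f\<close> gives \<open>f\<^sub>n = e f\<^sub>n + e f\<^sub>n\<close>. Multiplying by \<open>e = e\<^sup>2\<close>
  and cancelling yields \<open>e f\<^sub>n = 0\<close>, hence \<open>f\<^sub>n = 0\<close>.
\<close>

lemma splits_0: "splits (0 :: 'k \<Rightarrow> nat) = {(0, 0)}"
  by (auto simp: splits_def fun_eq_iff)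

lemma mfps_coeff_mult_0:
  fixes f g :: "('a::comm_semiring_1, 'k::finite) mfps"
  shows "mfps_coeff (f * g) 0 = mfps_coeff f 0 * mfps_coeff g 0"
  by (simp add: times_mfps.rep_eq splits_0)

text \<open>\<open>i\<close> nowhere exceeds \<open>n\<close> and is strictly smaller where
  \<open>j\<close> is positive. This makes total degree a usable induction measure for the factors
  of a monomial.\<close>

lemma sum_less_of_add_eq:
  fixes i j n :: "'k::finite \<Rightarrow> nat"
  assumes "i + j = n" "j \<noteq> 0"
  shows "sum i UNIV < sum n UNIV"
proof -
  obtain x where "j x > 0"
    using assms(2) by (auto simp: fun_eq_iff)
  then show ?thesis
    using assms(1) by (intro sum_strict_mono_ex1) auto
qed

lemma idempotent_mfps_coeff_eq_0:
  fixes f :: "('a::comm_semiring_1, 'k::finite) mfps"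
  assumes cancel: "additively_cancellative TYPE('a)"
    and idem: "f * f = f"
    and "n \<noteq> 0"
  shows "mfps_coeff f n = 0"
  using \<open>n \<noteq> 0\<close>
proof (induction "sum n UNIV" arbitrary: n rule: less_induct)
  case less
  define e a where "e = mfps_coeff f 0" and "a = mfps_coeff f n"
  have ee: "e * e = e"
    unfolding e_def by (metis idem mfps_coeff_mult_0)
  have "a = (\<Sum>(i, j)\<in>splits n. mfps_coeff f i * mfps_coeff f j)"
    unfolding a_def by (metis idem times_mfps.rep_eq)
  also have "\<dots> = (\<Sum>(i, j)\<in>{(0, n), (n, 0)}. mfps_coeff f i * mfps_coeff f j)"
  proof (rule sum.mono_neutral_right)
    show "\<forall>p\<in>splits n - {(0, n), (n, 0)}. (case p of (i, j) \<Rightarrow> mfps_coeff f i * mfps_coeff f j) = 0"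
    proof
      fix p
      assume p: "p \<in> splits n - {(0, n), (n, 0)}"
      obtain i j where ij: "p = (i, j)"
        by fastforce
      with p have "i + j = n" "i \<noteq> 0" "j \<noteq> 0"
        by auto
      \<comment> \<open>\<open>j \<noteq> 0\<close> gives \<open>i\<close> smaller degree than
        \<open>n\<close>, and \<open>i \<noteq> 0\<close> admits it to the induction
        hypothesis.\<close>
      then have "mfps_coeff f i = 0"
        using less.hyps sum_less_of_add_eq by blast
      then show "(case p of (i, j) \<Rightarrow> mfps_coeff f i * mfps_coeff f j) = 0"
        by (simp add: ij)
    qed
  qed auto
  \<comment> \<open>As \<open>n \<noteq> 0\<close>, the two pairs are distinct and contribute one
    term each.\<close>
  also have "\<dots> = e * a + e * a"
    using less.prems by (simp add: e_def a_def mult.commute)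
  finally have a: "a = e * a + e * a" .
  then have "e * a = e * (e * a + e * a)"
    by (rule arg_cong)
  also have "\<dots> = e * a + e * a"
    by (simp add: distrib_left ee flip: mult.assoc)
  \<comment> \<open>The added zero gives the equation the shape that cancellation needs.\<close>
  finally have "e * a + e * a = e * a + 0"
    by simp
  then have "e * a = 0"
    using cancel unfolding additively_cancellative_def by blast
  with a show ?case
    by (simp add: a_def)
qed

theorem theorem6p4:
  fixes f :: "('a::comm_semiring_1, 'k::finite) mfps"
  assumes "additively_cancellative TYPE('a)"
  shows "mult_idempotent f \<longleftrightarrow> (\<exists>e :: 'a. mult_idempotent e \<and> f = mfps_const e)"
proof
  assume "mult_idempotent f"
  then have idem: "f * f = f"
    by (simp add: mult_idempotent_def power2_eq_square)
  have "mult_idempotent (mfps_coeff f 0)"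
    unfolding mult_idempotent_def power2_eq_square by (metis idem mfps_coeff_mult_0)
  moreover have "f = mfps_const (mfps_coeff f 0)"
    using idempotent_mfps_coeff_eq_0 [OF assms idem]
    by (simp add: mfps_eq_iff mfps_const.rep_eq)
  ultimately show "\<exists>e. mult_idempotent e \<and> f = mfps_const e"
    by blast
next
  assume "\<exists>e. mult_idempotent e \<and> f = mfps_const e"
  \<comment> \<open>The embedding of constants is multiplicative, so it preserves
    idempotents.\<close>
  then show "mult_idempotent f"
    by (auto simp: mult_idempotent_def power2_eq_square simp flip: mfps_const_mult)
qed

end
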